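(* There is an absolute constant $c>0$ such that for every integer $d \geq 4$ and every positive integer $k \leq d$, there exists a set $\mathcal{H}$ of hyperplanes in $\mathbb{R}^d$ with $$\operatorname{vcdim}\left(\Delta_k(\mathcal{H})\right) \geq c\, d\, k \log k,$$ i.e. $\operatorname{vcdim}(\Delta_k(\mathcal{H})) = \Omega(d \cdot k\log k)$.
   Context: For a set $\mathcal{H}$ of hyperplanes in $\mathbb{R}^d$ and an integer $1 \le k \le d$, define the set system on ground set $\mathcal{H}$ $$\Delta_k(\mathcal{H}) = \{ H \subseteq \mathcal{H} : \text{there is an open } k\text{-dimensional simplex } \Delta \text{ in } \mathbb{R}^d \text{ such that } H = \{h \in \mathcal{H} : h \cap \Delta \neq \emptyset\}\},$$ where an open $k$-dimensional simplex is the relative interior of the convex hull of $k+1$ affinely independent points of $\mathbb{R}^d$. For a set system $(X,\mathcal{R})$ and $Y \subseteq X$, $\mathcal{R}$ shatters $Y$ if $\{Y \cap R : R \in \mathcal{R}\}$ is the full power set of $Y$; $\operatorname{vcdim}(\mathcal{R})$ is the largest size of a subset of $X$ shattered by $\mathcal{R}$. Logarithms are base 2. *)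

theory Defs
  imports Complex_Main "HOL-Library.Extended_Nat"
begin

text \<open>Points of R^d are represented as functions nat => real vanishing at
coordinates >= d (the dimension d varies inside the statement).\<close>

definition euclid :: "nat \<Rightarrow> (nat \<Rightarrow> real) set" where
  "euclid d = {x. \<forall>i\<ge>d. x i = 0}"

definition edist :: "nat \<Rightarrow> (nat \<Rightarrow> real) \<Rightarrow> (nat \<Rightarrow> real) \<Rightarrow> real" where
  "edist d x y = sqrt (\<Sum>i<d. (x i - y i)^2)"

definition hyperplane :: "nat \<Rightarrow> (nat \<Rightarrow> real) set \<Rightarrow> bool" where
  "hyperplane d h \<longleftrightarrow> (\<exists>a b. (\<exists>i<d. a i \<noteq> 0) \<and>
      h = {x \<in> euclid d. (\<Sum>i<d. a i * x i) = b})"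

definition aff_indep :: "nat \<Rightarrow> (nat \<Rightarrow> nat \<Rightarrow> real) \<Rightarrow> bool" where
  "aff_indep k p \<longleftrightarrow> (\<forall>\<mu>::nat \<Rightarrow> real. (\<Sum>j\<le>k. \<mu> j) = 0 \<and>
      (\<forall>i. (\<Sum>j\<le>k. \<mu> j * p j i) = 0) \<longrightarrow> (\<forall>j\<le>k. \<mu> j = 0))"

definition conv_hull_pts :: "nat \<Rightarrow> (nat \<Rightarrow> nat \<Rightarrow> real) \<Rightarrow> (nat \<Rightarrow> real) set" where
  "conv_hull_pts k p = {x. \<exists>w::nat \<Rightarrow> real. (\<forall>j\<le>k. w j \<ge> 0) \<and> (\<Sum>j\<le>k. w j) = 1 \<and>
      x = (\<lambda>i. \<Sum>j\<le>k. w j * p j i)}"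

definition aff_hull_pts :: "nat \<Rightarrow> (nat \<Rightarrow> nat \<Rightarrow> real) \<Rightarrow> (nat \<Rightarrow> real) set" where
  "aff_hull_pts k p = {x. \<exists>w::nat \<Rightarrow> real. (\<Sum>j\<le>k. w j) = 1 \<and>
      x = (\<lambda>i. \<Sum>j\<le>k. w j * p j i)}"

definition rel_int :: "nat \<Rightarrow> (nat \<Rightarrow> real) set \<Rightarrow> (nat \<Rightarrow> real) set \<Rightarrow> (nat \<Rightarrow> real) set" where
  "rel_int d A S = {x \<in> S. \<exists>e>0. \<forall>y\<in>A. edist d x y < e \<longrightarrow> y \<in> S}"

definition open_simplex :: "nat \<Rightarrow> nat \<Rightarrow> (nat \<Rightarrow> nat \<Rightarrow> real) \<Rightarrow> (nat \<Rightarrow> real) set" where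
  "open_simplex d k p = rel_int d (aff_hull_pts k p) (conv_hull_pts k p)"

definition Delta_k :: "nat \<Rightarrow> nat \<Rightarrow> (nat \<Rightarrow> real) set set \<Rightarrow> (nat \<Rightarrow> real) set set set" where
  "Delta_k d k \<H> = {H. \<exists>p. (\<forall>j\<le>k. p j \<in> euclid d) \<and> aff_indep k p \<and>
      H = {h \<in> \<H>. h \<inter> open_simplex d k p \<noteq> {}}}"

definition shatters :: "'a set set \<Rightarrow> 'a set \<Rightarrow> bool" where
  "shatters R Y \<longleftrightarrow> {Y \<inter> S | S. S \<in> R} = Pow Y"

definition vcdim :: "'a set \<Rightarrow> 'a set set \<Rightarrow> enat" where
  "vcdim X R = Sup {enat (card Y) | Y. Y \<subseteq> X \<and> finite Y \<and> shatters R Y}"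

end

theory Submission
  imports Defs "Jordan_Normal_Form.Char_Poly"
begin

text \<open>A hyperplane meets an open simplex if it strictly separates two vertices. If vertex \<open>0\<close> is far
  away on the positive side of all hyperplanes, the hyperplanes met are those having one of the
  other \<open>k\<close> vertices on their negative side. Replacing coordinates \<open>z\<close> by \<open>8\<^sup>z\<close> and \<open>8\<^sup>-\<^sup>z\<close> turns
  membership of a point in a box constrained in two coordinates into the sign of an affine form with
  four nonzero coefficients. So it suffices to find \<open>\<Omega>(k log k)\<close> boxes in the plane such that
  every subfamily is exactly the family of boxes hit by some \<open>k\<close> points \<open>(x, y(x))\<close>: about \<open>d/2\<close> independent
  functions \<open>y\<close> sharing the same \<open>x\<close> then give the factor \<open>d\<close>.

  For \<open>k = 2\<^sup>n\<close> the bits of \<open>y(x)\<close> are produced by a butterfly network fed with the bits of \<open>x\<close>.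
  At each of its \<open>n - 1\<close> stages a prefix of \<open>x\<close> and a prefix of \<open>y\<close> select a switch, which decides
  whether the dyadic box belonging to this pair of prefixes is hit. The network is a bijection for
  every setting of the switches, so all \<open>(n - 1) 2\<^sup>n\<^sup>-\<^sup>2\<close> of them act independently.\<close>

section \<open>A switching network\<close>

text \<open>State \<open>(A, B, s)\<close>: unread high bits of \<open>x\<close>, output bits written so far, one buffered bit.
  Stage \<open>t\<close> reads the lowest unread bit and writes either it or the buffered bit, keeping the
  other one, according to a switch that depends only on \<open>t\<close>, \<open>A div 2\<close> and \<open>B\<close>.\<close>

fun net :: "(nat \<Rightarrow> nat \<Rightarrow> nat \<Rightarrow> bool) \<Rightarrow> nat \<Rightarrow> nat \<Rightarrow> nat \<times> nat \<times> nat" where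
  "net \<sigma> 0 x = (x div 2, 0, x mod 2)"
| "net \<sigma> (Suc t) x = (case net \<sigma> t x of (A, B, s) \<Rightarrow>
     if \<sigma> t (A div 2) B then (A div 2, 2 * B + s, A mod 2) else (A div 2, 2 * B + A mod 2, s))"

definition net_out :: "(nat \<Rightarrow> nat \<Rightarrow> nat \<Rightarrow> bool) \<Rightarrow> nat \<Rightarrow> nat \<Rightarrow> nat" where
  "net_out \<sigma> t x = fst (snd (net \<sigma> t x))"

lemma fst_net: "fst (net \<sigma> t x) = x div 2 ^ Suc t"
  by (induction t) (auto split: prod.split simp: div_mult2_eq[symmetric] mult.commute)

lemma net_buffer_less_2: "snd (snd (net \<sigma> t x)) < 2"
  by (induction t) (auto split: prod.split)

lemma net_out_Suc_div_2: "net_out \<sigma> (Suc t) x div 2 = net_out \<sigma> t x"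
  using net_buffer_less_2[of \<sigma> t x]
  by (auto simp: net_out_def split: prod.split)

text \<open>Each later stage only appends one bit below those already written, so a prefix of the
  output is final once written.\<close>

lemma net_out_add_div: "net_out \<sigma> (t + u) x div 2 ^ u = net_out \<sigma> t x"
proof (induction u)
  case (Suc u)
  have "net_out \<sigma> (t + Suc u) x div 2 ^ Suc u = net_out \<sigma> (Suc (t + u)) x div 2 div 2 ^ u"
    by (simp add: div_mult2_eq)
  then show ?case using Suc by (simp add: net_out_Suc_div_2)
qed simp

text \<open>Each stage is invertible: its switch depends only on \<open>A div 2\<close> and
  \<open>B\<close>, and both can still be read off from the state after the stage.\<close>

lemma net_surj:
  assumes "t \<le> N" "A < 2 ^ (N - t)" "B < 2 ^ t" "s < 2"
  shows "\<exists>x < 2 ^ Suc N. net \<sigma> t x = (A, B, s)"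
  using assms
proof (induction t arbitrary: A B s)
  case 0
  then show ?case by (intro exI[of _ "2 * A + s"]) auto
next
  case (Suc t)
  define b where "b = B div 2"
  \<comment> \<open>\<open>c\<close> is the bit read and \<open>s'\<close> the bit buffered before
    the stage; the switch says which of them was written as \<open>B mod 2\<close> and which is left
    as \<open>s\<close>.\<close>
  define c where "c = (if \<sigma> t A b then s else B mod 2)"
  define s' where "s' = (if \<sigma> t A b then B mod 2 else s)"
  have c: "c < 2" and s': "s' < 2" using Suc.prems by (auto simp: c_def s'_def)
  have "N - t = Suc (N - Suc t)" using Suc.prems by simp
  then have "2 * A + c < 2 ^ (N - t)" using Suc.prems(2) c by simp
  moreover have "b < 2 ^ t" using Suc.prems(3) by (auto simp: b_def)
  ultimately obtain x where x: "x < 2 ^ Suc N" "net \<sigma> t x = (2 * A + c, b, s')"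
    using Suc.IH[of "2 * A + c" b s'] Suc.prems(1) s' by auto
  have "(2 * A + c) div 2 = A" "(2 * A + c) mod 2 = c" using c by auto
  then have "net \<sigma> (Suc t) x = (A, B, s)"
    using x(2) by (auto simp: c_def s'_def b_def)
  with x(1) show ?case by blast
qed

text \<open>With \<open>2 * A\<close> unread, the bit read at stage \<open>t\<close> is 0, so a
  written 1 can only be the buffered bit, released by the switch. Conversely \<open>net_surj\<close>
  supplies an input whose buffered bit is 1.\<close>

lemma net_hits_box_iff:
  assumes "t < N" "A < 2 ^ (N - 1 - t)" "B < 2 ^ t"
  shows "(\<exists>x < 2 ^ Suc N. x div 2 ^ Suc t = 2 * A \<and> net_out \<sigma> N x div 2 ^ (N - 1 - t) = 2 * B + 1)
    \<longleftrightarrow> \<sigma> t A B"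
proof -
  have out: "net_out \<sigma> N x div 2 ^ (N - 1 - t) = net_out \<sigma> (Suc t) x" for x
    using net_out_add_div[of \<sigma> "Suc t" "N - 1 - t" x] assms(1) by simp
  show ?thesis
  proof
    assume "\<exists>x < 2 ^ Suc N. x div 2 ^ Suc t = 2 * A \<and> net_out \<sigma> N x div 2 ^ (N - 1 - t) = 2 * B + 1"
    then obtain x where x: "fst (net \<sigma> t x) = 2 * A" "net_out \<sigma> (Suc t) x = 2 * B + 1"
      unfolding out fst_net by blast
    obtain b s where net: "net \<sigma> t x = (2 * A, b, s)"
      using x(1) by (cases "net \<sigma> t x") auto
    have "net_out \<sigma> t x = B" using net_out_Suc_div_2[of \<sigma> t x] x(2) by simp
    then have "b = B" using net by (simp add: net_out_def)
    then show "\<sigma> t A B" using net x(2) by (auto simp: net_out_def split: if_splits)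
  next
    assume \<sigma>: "\<sigma> t A B"
    have "N - t = Suc (N - 1 - t)" using assms(1) by simp
    then have "2 * A < 2 ^ (N - t)" using assms(2) by simp
    then obtain x where x: "x < 2 ^ Suc N" "net \<sigma> t x = (2 * A, B, 1)"
      using net_surj[of t N "2 * A" B 1 \<sigma>] assms by auto
    have "x div 2 ^ Suc t = 2 * A" using fst_net[of \<sigma> t x] x(2) by simp
    moreover have "net_out \<sigma> (Suc t) x = 2 * B + 1"
      using x(2) \<sigma> by (simp add: net_out_def)
    ultimately show "\<exists>x < 2 ^ Suc N. x div 2 ^ Suc t = 2 * A \<and> net_out \<sigma> N x div 2 ^ (N - 1 - t) = 2 * B + 1"
      using x(1) out by auto
  qed
qed

section \<open>Open simplices with a coordinate inverse\<close>

text \<open>Such a \<open>B\<close> recovers barycentric coordinates linearly, which yields both affine independence and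
  the description of the relative interior by positive weights.\<close>

definition edge_inverse :: "nat \<Rightarrow> (nat \<Rightarrow> nat \<Rightarrow> real) \<Rightarrow> (nat \<Rightarrow> nat \<Rightarrow> real) \<Rightarrow> bool" where
  "edge_inverse k B p \<longleftrightarrow>
    (\<forall>l<k. \<forall>j<k. (\<Sum>i<k. B l i * (p (Suc j) i - p 0 i)) = (if l = j then 1 else 0))"

text \<open>As the coefficients sum to 0, the combination of the points is one of the edge vectors
  at \<open>p 0\<close>, whose matrix is inverted by \<open>B\<close>.\<close>

lemma edge_inverse_recovers:
  assumes "edge_inverse k B p" "(\<Sum>j\<le>k. \<mu> j) = 0" "l < k"
  shows "(\<Sum>i<k. B l i * (\<Sum>j\<le>k. \<mu> j * p j i)) = \<mu> (Suc l)"
proof -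
  have \<mu>0: "\<mu> 0 = - (\<Sum>j<k. \<mu> (Suc j))"
    using assms(2) by (simp add: sum.atMost_shift)
  have "(\<Sum>j\<le>k. \<mu> j * p j i) = (\<Sum>j<k. \<mu> (Suc j) * (p (Suc j) i - p 0 i))" for i
    by (simp add: sum.atMost_shift \<mu>0 sum_distrib_right right_diff_distrib sum_subtractf)
  then have "(\<Sum>i<k. B l i * (\<Sum>j\<le>k. \<mu> j * p j i))
      = (\<Sum>i<k. \<Sum>j<k. \<mu> (Suc j) * (B l i * (p (Suc j) i - p 0 i)))"
    by (simp add: sum_distrib_left mult_ac)
  also have "\<dots> = (\<Sum>j<k. \<mu> (Suc j) * (\<Sum>i<k. B l i * (p (Suc j) i - p 0 i)))"
    by (subst sum.swap) (simp add: sum_distrib_left)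
  also have "\<dots> = (\<Sum>j<k. if j = l then \<mu> (Suc j) else 0)"
    using assms(1,3) by (intro sum.cong) (auto simp: edge_inverse_def)
  also have "\<dots> = \<mu> (Suc l)" using assms(3) by (simp add: sum.delta)
  finally show ?thesis .
qed

lemma edge_inverse_aff_indep:
  assumes "edge_inverse k B p"
  shows "aff_indep k p"
  unfolding aff_indep_def
proof (intro allI impI)
  fix \<mu> :: "nat \<Rightarrow> real" and j
  assume \<mu>: "(\<Sum>j\<le>k. \<mu> j) = 0 \<and> (\<forall>i. (\<Sum>j\<le>k. \<mu> j * p j i) = 0)" and j: "j \<le> k"
  have *: "\<mu> (Suc l) = 0" if "l < k" for l
    using edge_inverse_recovers[OF assms _ that, of \<mu>] \<mu> by simp
  moreover have "\<mu> 0 = 0" using \<mu> * by (simp add: sum.atMost_shift)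
  ultimately show "\<mu> j = 0" using j by (cases j) auto
qed

lemma abs_diff_le_edist:
  assumes "i < d"
  shows "\<bar>x i - y i\<bar> \<le> edist d x y"
proof -
  have "(x i - y i)\<^sup>2 \<le> (\<Sum>i<d. (x i - y i)\<^sup>2)"
    using assms by (intro member_le_sum) auto
  then have "sqrt ((x i - y i)\<^sup>2) \<le> edist d x y"
    unfolding edist_def by (rule real_sqrt_le_mono)
  then show ?thesis by simp
qed

text \<open>By means of \<open>B\<close>, barycentric coordinates change by at most a constant times
  the distance, so positive weights stay nonnegative at nearby points of the affine hull.\<close>

lemma positive_combination_in_open_simplex:
  assumes inv: "edge_inverse k B p" and "k \<le> d"
    and w: "\<And>j. j \<le> k \<Longrightarrow> w j > 0" "(\<Sum>j\<le>k. w j) = 1"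
  shows "(\<lambda>i. \<Sum>j\<le>k. w j * p j i) \<in> open_simplex d k p"
proof -
  define x where "x = (\<lambda>i. \<Sum>j\<le>k. w j * p j i)"
  define m where "m = Min (w ` {..k})"
  define C where "C = (\<Sum>l<k. \<Sum>i<k. \<bar>B l i\<bar>)"
  \<comment> \<open>Weights other than that of vertex 0 move by at most \<open>C * e\<close>, the
    weight of vertex 0 by at most \<open>k\<close> times as much; \<open>e\<close> keeps both below
    the smallest weight \<open>m\<close>.\<close>
  define e where "e = m / (1 + real (Suc k) * C)"
  have m: "m > 0" "\<And>j. j \<le> k \<Longrightarrow> m \<le> w j" using w(1) by (auto simp: m_def)
  have C: "C \<ge> 0" by (auto simp: C_def intro!: sum_nonneg)
  have pos: "1 + real (Suc k) * C > 0" using C by (simp add: add_pos_nonneg)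
  then have e: "e > 0" using m(1) by (simp add: e_def)
  have "real (Suc k) * (C * e) = m - e"
    using pos by (simp add: e_def field_simps)
  then have small: "real (Suc k) * (C * e) < m" using e by simp
  have Ce: "C * e \<ge> 0" using C e by simp
  have y_in: "y \<in> conv_hull_pts k p" if y: "y \<in> aff_hull_pts k p" "edist d x y < e" for y
  proof -
    obtain u where u: "(\<Sum>j\<le>k. u j) = 1" "y = (\<lambda>i. \<Sum>j\<le>k. u j * p j i)"
      using y(1) unfolding aff_hull_pts_def by blast
    define \<mu> where "\<mu> j = w j - u j" for j
    have \<mu>: "(\<Sum>j\<le>k. \<mu> j) = 0" using u(1) w(2) by (simp add: \<mu>_def sum_subtractf)
    have xy: "x i - y i = (\<Sum>j\<le>k. \<mu> j * p j i)" for i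
      by (simp add: x_def u(2) \<mu>_def left_diff_distrib sum_subtractf)
    have \<mu>S: "\<bar>\<mu> (Suc l)\<bar> \<le> C * e" if l: "l < k" for l
    proof -
      have "\<bar>\<mu> (Suc l)\<bar> = \<bar>\<Sum>i<k. B l i * (x i - y i)\<bar>"
        using edge_inverse_recovers[OF inv \<mu> l] by (simp add: xy)
      also have "\<dots> \<le> (\<Sum>i<k. \<bar>B l i * (x i - y i)\<bar>)" by (rule sum_abs)
      also have "\<dots> \<le> (\<Sum>i<k. \<bar>B l i\<bar> * e)"
      proof (rule sum_mono)
        fix i assume "i \<in> {..<k}"
        then have "\<bar>x i - y i\<bar> \<le> e"
          using abs_diff_le_edist[of i d x y] y(2) \<open>k \<le> d\<close> by auto
        then show "\<bar>B l i * (x i - y i)\<bar> \<le> \<bar>B l i\<bar> * e"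
          by (simp add: abs_mult mult_left_mono)
      qed
      also have "\<dots> = (\<Sum>i<k. \<bar>B l i\<bar>) * e" by (simp add: sum_distrib_right)
      also have "\<dots> \<le> C * e"
        unfolding C_def using l e
        by (intro mult_right_mono member_le_sum[of l "{..<k}" "\<lambda>l. \<Sum>i<k. \<bar>B l i\<bar>"])
          (auto intro: sum_nonneg)
      finally show ?thesis .
    qed
    have le: "\<bar>\<mu> j\<bar> \<le> real (Suc k) * (C * e)" if j: "j \<le> k" for j
    proof (cases j)
      case 0
      have "\<mu> 0 = - (\<Sum>l<k. \<mu> (Suc l))" using \<mu> by (simp add: sum.atMost_shift)
      then have "\<bar>\<mu> 0\<bar> \<le> (\<Sum>l<k. \<bar>\<mu> (Suc l)\<bar>)" by (simp add: sum_abs)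
      also have "\<dots> \<le> (\<Sum>l<k. C * e)" using \<mu>S by (intro sum_mono) auto
      also have "\<dots> \<le> real (Suc k) * (C * e)" using Ce by (simp add: algebra_simps)
      finally show ?thesis using 0 by simp
    next
      case (Suc l)
      have "1 * (C * e) \<le> real (Suc k) * (C * e)" using Ce by (intro mult_right_mono) auto
      then show ?thesis using \<mu>S[of l] Suc j by simp
    qed
    have "u j \<ge> 0" if "j \<le> k" for j
      using le[OF that] small m(2)[OF that] by (simp add: \<mu>_def)
    then show ?thesis using u unfolding conv_hull_pts_def by blast
  qed
  moreover have "x \<in> conv_hull_pts k p"
    using w less_imp_le unfolding conv_hull_pts_def x_def by blast
  ultimately show ?thesis
    using e unfolding open_simplex_def rel_int_def x_def by blast
qed

section \<open>Hyperplanes meeting or missing an open simplex\<close>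

text \<open>Weight 1 on all other indices leaves a rest \<open>s\<close>. As \<open>f 0\<close> and
  \<open>f j\<close> have opposite signs, positive weights on these two can cancel it; normalising
  follows.\<close>

lemma positive_weights_balancing:
  fixes f :: "nat \<Rightarrow> real"
  assumes "f 0 > 0" "1 \<le> j" "j \<le> k" "f j < 0"
  obtains w where "\<And>i. i \<le> k \<Longrightarrow> w i > 0" "(\<Sum>i\<le>k. w i) = (1::real)" "(\<Sum>i\<le>k. w i * f i) = 0"
proof -
  define s where "s = sum f ({..k} - {0, j})"
  obtain a b where ab: "a > 0" "b > 0" "a * f 0 + b * f j + s = 0"
  proof (cases "s \<ge> 0")
    case True
    show ?thesis
    proof (rule that[of 1 "(s + f 0) / (- f j)"])
      show "(s + f 0) / (- f j) > 0" using True assms by (intro divide_pos_pos) auto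
    qed (use assms in \<open>auto simp: field_simps\<close>)
  next
    case False
    show ?thesis
    proof (rule that[of "(- s - f j) / f 0" 1])
      show "(- s - f j) / f 0 > 0" using False assms by (intro divide_pos_pos) auto
    qed (use assms in \<open>auto simp: field_simps\<close>)
  qed
  define v where "v i = (if i = 0 then a else if i = j then b else 1)" for i :: nat
  have v: "v i > 0" for i using ab by (simp add: v_def)
  have split: "sum g {..k} = g 0 + g j + sum g ({..k} - {0, j})" for g :: "nat \<Rightarrow> real"
    using assms sum.subset_diff[of "{0, j}" "{..k}" g] by (simp add: algebra_simps)
  have "(\<Sum>i\<in>{..k} - {0, j}. v i * f i) = s"
    unfolding s_def by (rule sum.cong) (auto simp: v_def)
  then have vf: "(\<Sum>i\<le>k. v i * f i) = 0"
    using ab(3) assms(2) by (simp add: split[of "\<lambda>i. v i * f i"]) (simp add: v_def)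
  define W where "W = (\<Sum>i\<le>k. v i)"
  have W: "W > 0" unfolding W_def using v by (intro sum_pos) auto
  show ?thesis
  proof (rule that[of "\<lambda>i. v i / W"])
    show "(\<Sum>i\<le>k. v i / W) = 1" using W by (simp add: sum_divide_distrib[symmetric] W_def)
    show "(\<Sum>i\<le>k. v i / W * f i) = 0" using vf by (simp add: sum_divide_distrib[symmetric])
  qed (use v W in auto)
qed

lemma sum_combination_swap:
  fixes a :: "nat \<Rightarrow> real"
  shows "(\<Sum>i<d. a i * (\<Sum>j\<le>k. w j * p j i)) = (\<Sum>j\<le>k. w j * (\<Sum>i<d. a i * p j i))"
  by (simp add: sum_distrib_left) (subst sum.swap, simp add: mult_ac)

text \<open>Balancing the signed values at the vertices by positive weights gives a point of the
  open simplex on the hyperplane.\<close>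

lemma hyperplane_meets_open_simplex:
  fixes a :: "nat \<Rightarrow> real"
  assumes "edge_inverse k B p" "k \<le> d" "\<And>j. j \<le> k \<Longrightarrow> p j \<in> euclid d"
    and "(\<Sum>i<d. a i * p 0 i) > b" "1 \<le> j" "j \<le> k" "(\<Sum>i<d. a i * p j i) < b"
  shows "{x \<in> euclid d. (\<Sum>i<d. a i * x i) = b} \<inter> open_simplex d k p \<noteq> {}"
proof -
  obtain w where w: "\<And>i. i \<le> k \<Longrightarrow> w i > 0" "(\<Sum>i\<le>k. w i) = 1"
    "(\<Sum>j\<le>k. w j * ((\<Sum>i<d. a i * p j i) - b)) = 0"
    using positive_weights_balancing[of "\<lambda>j. (\<Sum>i<d. a i * p j i) - b" j k] assms by auto
  let ?x = "\<lambda>i. \<Sum>j\<le>k. w j * p j i"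
  have "(\<Sum>j\<le>k. w j * (\<Sum>i<d. a i * p j i)) = b"
    using w(2,3) by (simp add: right_diff_distrib sum_subtractf sum_distrib_right[symmetric])
  then have "(\<Sum>i<d. a i * ?x i) = b" by (simp add: sum_combination_swap)
  moreover have "?x \<in> euclid d" using assms(3) by (simp add: euclid_def)
  moreover have "?x \<in> open_simplex d k p"
    using assms(1,2) w(1,2) by (rule positive_combination_in_open_simplex)
  ultimately show ?thesis by blast
qed

text \<open>All vertices lie in one open half-space, which is convex.\<close>

lemma hyperplane_misses_open_simplex:
  fixes a :: "nat \<Rightarrow> real"
  assumes "\<And>j. j \<le> k \<Longrightarrow> (\<Sum>i<d. a i * p j i) > b"
  shows "{x \<in> euclid d. (\<Sum>i<d. a i * x i) = b} \<inter> open_simplex d k p = {}"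
proof -
  have "(\<Sum>i<d. a i * x i) > b" if "x \<in> conv_hull_pts k p" for x
  proof -
    obtain w where w: "\<forall>j\<le>k. w j \<ge> 0" "(\<Sum>j\<le>k. w j) = 1" "x = (\<lambda>i. \<Sum>j\<le>k. w j * p j i)"
      using \<open>x \<in> conv_hull_pts k p\<close> unfolding conv_hull_pts_def by blast
    obtain j where j: "j \<le> k" "w j > 0"
    proof (rule ccontr)
      assume "\<not> thesis"
      then have "w j = 0" if "j \<le> k" for j using that w(1) \<open>\<And>j. \<lbrakk>j \<le> k; 0 < w j\<rbrakk> \<Longrightarrow> thesis\<close> by force
      then show False using w(2) by simp
    qed
    have "0 < (\<Sum>j\<le>k. w j * ((\<Sum>i<d. a i * p j i) - b))"
      using w(1) assms j by (intro sum_pos2[of _ j]) (auto simp: less_imp_le)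
    then show ?thesis
      using w(2,3) by (simp add: sum_combination_swap right_diff_distrib sum_subtractf
          sum_distrib_right[symmetric])
  qed
  then show ?thesis unfolding open_simplex_def rel_int_def by fastforce
qed

section \<open>Perturbation to general position\<close>

text \<open>Adding \<open>t\<close> where \<open>j = Suc i\<close> turns the edge matrix
  \<open>V\<close> into \<open>V\<close> plus \<open>t\<close> times the identity, which is singular
  only if \<open>- t\<close> is one of the finitely many eigenvalues of \<open>V\<close>.\<close>

lemma eventually_edge_inverse:
  fixes v :: "nat \<Rightarrow> nat \<Rightarrow> real"
  shows "eventually (\<lambda>t. \<exists>B. edge_inverse k B
    (\<lambda>j i. v j i + (if j = Suc i then t else 0))) (at_right 0)"
proof -
  define V where "V = mat k k (\<lambda>(i, j). v (Suc j) i - v 0 i)"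
  have V: "V \<in> carrier_mat k k" by (simp add: V_def)
  let ?roots = "{r. poly (char_poly V) (- r) = 0}"
  have "char_poly V \<noteq> 0" using degree_monic_char_poly[OF V] by auto
  then have "finite {r. poly (char_poly V) r = 0}" by (rule poly_roots_finite)
  moreover have "?roots = uminus ` {r. poly (char_poly V) r = 0}"
    by (auto simp: image_iff) (metis minus_minus)
  ultimately have "finite ?roots" by simp
  then have "eventually (\<lambda>t. \<forall>r\<in>?roots. t \<noteq> r) (at_right 0)"
    by (intro eventually_ball_finite) (auto intro: eventually_neq_at_within)
  then show ?thesis
  proof (rule eventually_mono)
    fix t assume "\<forall>r\<in>?roots. t \<noteq> r"
    then have "\<not> eigenvalue V (- t)" using eigenvalue_root_char_poly[OF V] by auto
    then have "det (char_matrix V (- t)) \<noteq> 0" using eigenvalue_det[OF V] by auto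
    moreover define W where "W = char_matrix V (- t)"
    have W: "W \<in> carrier_mat k k" using V by (simp add: W_def)
    ultimately have "W \<in> Units (ring_mat TYPE(real) k ())"
      using det_non_zero_imp_unit[OF W] by (simp add: W_def)
    then obtain B where B: "B * W = 1\<^sub>m k" "B \<in> carrier_mat k k"
      unfolding Units_def ring_mat_def by auto
    have Wij: "W $$ (i, j) = v (Suc j) i - v 0 i + (if i = j then t else 0)" if "i < k" "j < k" for i j
      using that V by (auto simp: W_def char_matrix_def V_def)
    have "(\<Sum>i<k. B $$ (l, i) * W $$ (i, j)) = (if l = j then 1 else 0)" if "l < k" "j < k" for l j
      using arg_cong[OF B(1), of "\<lambda>M. M $$ (l, j)"] that B(2) W
      by (simp add: scalar_prod_def atLeast0LessThan)
    then have "edge_inverse k (\<lambda>l i. B $$ (l, i)) (\<lambda>j i. v j i + (if j = Suc i then t else 0))"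
      unfolding edge_inverse_def using Wij by (simp add: algebra_simps eq_commute)
    then show "\<exists>B. edge_inverse k B (\<lambda>j i. v j i + (if j = Suc i then t else 0))"
      by (rule exI[of _ "\<lambda>l i. B $$ (l, i)"])
  qed
qed

text \<open>Finitely many strict inequalities survive a small perturbation that makes the vertices
  affinely independent. With vertex 0 on the positive side throughout, hyperplane \<open>i\<close>
  is met if another vertex is on its negative side and missed if all are on the positive
  side.\<close>

lemma realize_hit_pattern:
  fixes a :: "'i \<Rightarrow> nat \<Rightarrow> real" and v :: "nat \<Rightarrow> nat \<Rightarrow> real"
  assumes "finite I" "k \<le> d"
    and v0: "\<And>i. i \<in> I \<Longrightarrow> (\<Sum>q<d. a i q * v 0 q) > 1"
    and hit: "\<And>i. i \<in> S \<Longrightarrow> \<exists>j. 1 \<le> j \<and> j \<le> k \<and> (\<Sum>q<d. a i q * v j q) < 1"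
    and miss: "\<And>i j. i \<in> I - S \<Longrightarrow> 1 \<le> j \<Longrightarrow> j \<le> k \<Longrightarrow> (\<Sum>q<d. a i q * v j q) > 1"
    and "S \<subseteq> I"
  obtains p where "\<And>j. j \<le> k \<Longrightarrow> p j \<in> euclid d" "aff_indep k p"
    "\<And>i. i \<in> I \<Longrightarrow>
      {x \<in> euclid d. (\<Sum>q<d. a i q * x q) = 1} \<inter> open_simplex d k p \<noteq> {} \<longleftrightarrow> i \<in> S"
proof -
  define v' where "v' j q = (if q < d then v j q else 0)" for j q
  define p where "p t j q = v' j q + (if j = Suc q then t else 0)" for t :: real and j q
  define f where "f i t j = (\<Sum>q<d. a i q * p t j q)" for i t j
  have f0: "f i 0 j = (\<Sum>q<d. a i q * v j q)" for i j
    by (simp add: f_def p_def v'_def)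
  have lim: "((\<lambda>t. f i t j) \<longlongrightarrow> f i 0 j) (at_right 0)" for i j
  proof -
    have "isCont (\<lambda>t. f i t j) 0"
      unfolding f_def p_def
      by (intro continuous_intros) (rename_tac q, case_tac "j = Suc q"; simp)
    then show ?thesis
      unfolding isCont_def by (rule tendsto_mono[rotated]) (simp add: at_le)
  qed
  have "eventually (\<lambda>t. \<forall>i\<in>I. \<forall>j\<in>{..k}. (f i 0 j < 1 \<longrightarrow> f i t j < 1) \<and> (f i 0 j > 1 \<longrightarrow> f i t j > 1))
      (at_right 0)"
  proof (intro eventually_ball_finite ballI \<open>finite I\<close> finite_atMost eventually_conj)
    fix i j
    show "eventually (\<lambda>t. f i 0 j < 1 \<longrightarrow> f i t j < 1) (at_right 0)"
      using order_tendstoD(2)[OF lim, of i j 1] by (cases "f i 0 j < 1") auto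
    show "eventually (\<lambda>t. f i 0 j > 1 \<longrightarrow> f i t j > 1) (at_right 0)"
      using order_tendstoD(1)[OF lim, of 1 i j] by (cases "f i 0 j > 1") auto
  qed
  moreover have "p = (\<lambda>t j q. v' j q + (if j = Suc q then t else 0))"
    by (simp add: p_def fun_eq_iff)
  then have "eventually (\<lambda>t. \<exists>B. edge_inverse k B (p t)) (at_right 0)"
    using eventually_edge_inverse[of k v'] by simp
  ultimately have ev: "eventually (\<lambda>t. (\<forall>i\<in>I. \<forall>j\<in>{..k}. (f i 0 j < 1 \<longrightarrow> f i t j < 1) \<and> (f i 0 j > 1 \<longrightarrow> f i t j > 1))
      \<and> (\<exists>B. edge_inverse k B (p t))) (at_right 0)"
    by (rule eventually_conj)
  obtain t where
    "(\<forall>i\<in>I. \<forall>j\<in>{..k}. (f i 0 j < 1 \<longrightarrow> f i t j < 1) \<and> (f i 0 j > 1 \<longrightarrow> f i t j > 1))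
      \<and> (\<exists>B. edge_inverse k B (p t))"
    using eventually_happens'[OF trivial_limit_at_right_real ev] by blast
  then obtain B where B: "edge_inverse k B (p t)"
    and t: "\<And>i j. i \<in> I \<Longrightarrow> j \<le> k \<Longrightarrow> (f i 0 j < 1 \<longrightarrow> f i t j < 1) \<and> (f i 0 j > 1 \<longrightarrow> f i t j > 1)"
    by auto
  show ?thesis
  proof (rule that[of "p t"])
    show euc: "p t j \<in> euclid d" if "j \<le> k" for j
      using that \<open>k \<le> d\<close> by (auto simp: euclid_def p_def v'_def)
    show "aff_indep k (p t)" using B by (rule edge_inverse_aff_indep)
    fix i assume i: "i \<in> I"
    have p0: "(\<Sum>q<d. a i q * p t 0 q) > 1"
      using t[OF i, of 0] v0[OF i] f0[of i 0] by (simp add: f_def)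
    show "{x \<in> euclid d. (\<Sum>q<d. a i q * x q) = 1} \<inter> open_simplex d k (p t) \<noteq> {} \<longleftrightarrow> i \<in> S"
    proof (cases "i \<in> S")
      case True
      obtain j where j: "1 \<le> j" "j \<le> k" "f i 0 j < 1" using hit[OF True] f0 by auto
      have "(\<Sum>q<d. a i q * p t j q) < 1" using t[OF i j(2)] j(3) by (simp add: f_def)
      then show ?thesis
        using hyperplane_meets_open_simplex[OF B \<open>k \<le> d\<close> euc p0 j(1,2)] True by simp
    next
      case False
      have "(\<Sum>q<d. a i q * p t j q) > 1" if j: "j \<le> k" for j
      proof (cases "j = 0")
        case False
        then show ?thesis using miss[of i j] t[OF i j] f0[of i j] i j \<open>i \<notin> S\<close> by (simp add: f_def)
      qed (use p0 in simp)
      then show ?thesis using hyperplane_misses_open_simplex[of k 1 "a i" "p t" d] False by simp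
    qed
  qed
qed

section \<open>From sign patterns of points to shattered hyperplanes\<close>

text \<open>\<open>base\<close> serves as vertex 0 and the \<open>k\<close> points of a pattern,
  possibly coincident, as the other vertices.\<close>

lemma card_le_vcdim_Delta_k:
  fixes a :: "'i \<Rightarrow> nat \<Rightarrow> real" and base :: "nat \<Rightarrow> real"
  assumes "finite I" "k \<le> d"
    and base: "\<And>i. i \<in> I \<Longrightarrow> (\<Sum>q<d. a i q * base q) > 1"
    and pattern: "\<And>S. S \<subseteq> I \<Longrightarrow> \<exists>v.
        (\<forall>i\<in>S. \<exists>j<k. (\<Sum>q<d. a i q * v j q) < 1) \<and>
        (\<forall>i\<in>I - S. \<forall>j<k. (\<Sum>q<d. a i q * v j q) > 1)"
  shows "\<exists>\<H>. (\<forall>h\<in>\<H>. hyperplane d h) \<and> enat (card I) \<le> vcdim \<H> (Delta_k d k \<H>)"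
proof -
  define h where "h i = {x \<in> euclid d. (\<Sum>q<d. a i q * x q) = 1}" for i
  have real: "\<exists>p. (\<forall>j\<le>k. p j \<in> euclid d) \<and> aff_indep k p \<and>
      (\<forall>i\<in>I. h i \<inter> open_simplex d k p \<noteq> {} \<longleftrightarrow> i \<in> S)" if S: "S \<subseteq> I" for S
  proof -
    obtain v where v: "\<forall>i\<in>S. \<exists>j<k. (\<Sum>q<d. a i q * v j q) < 1"
      "\<forall>i\<in>I - S. \<forall>j<k. (\<Sum>q<d. a i q * v j q) > 1" using pattern[OF S] by blast
    define u where "u j = (if j = 0 then base else v (j - 1))" for j
    have hit: "\<exists>j. 1 \<le> j \<and> j \<le> k \<and> (\<Sum>q<d. a i q * u j q) < 1" if i: "i \<in> S" for i
    proof -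
      obtain j where "j < k" "(\<Sum>q<d. a i q * v j q) < 1" using v(1) i by blast
      then show ?thesis by (intro exI[of _ "Suc j"]) (auto simp: u_def)
    qed
    have u0: "(\<Sum>q<d. a i q * u 0 q) > 1" if "i \<in> I" for i
      using base[OF that] by (simp add: u_def)
    have miss: "(\<Sum>q<d. a i q * u j q) > 1" if "i \<in> I - S" "1 \<le> j" "j \<le> k" for i j
      using v(2) that by (simp add: u_def)
    obtain p where "\<And>j. j \<le> k \<Longrightarrow> p j \<in> euclid d" "aff_indep k p"
      "\<And>i. i \<in> I \<Longrightarrow>
        {x \<in> euclid d. (\<Sum>q<d. a i q * x q) = 1} \<inter> open_simplex d k p \<noteq> {} \<longleftrightarrow> i \<in> S"
      by (rule realize_hit_pattern[OF \<open>finite I\<close> \<open>k \<le> d\<close> u0 hit miss S]) blast+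
    then show ?thesis unfolding h_def by blast
  qed
  \<comment> \<open>Realising the pattern \<open>{i}\<close> tells \<open>h i\<close> from all other
    hyperplanes.\<close>
  have inj: "inj_on h I"
  proof (rule inj_onI)
    fix i j assume ij: "i \<in> I" "j \<in> I" "h i = h j"
    obtain p where "\<forall>l\<in>I. h l \<inter> open_simplex d k p \<noteq> {} \<longleftrightarrow> l \<in> {i}"
      using real[of "{i}"] ij(1) by auto
    then show "i = j" using ij by (metis singletonD singletonI)
  qed
  have "hyperplane d (h i)" if i: "i \<in> I" for i
  proof -
    have "\<exists>q<d. a i q \<noteq> 0" using base[OF i] by (rule contrapos_pp) simp
    then show ?thesis unfolding hyperplane_def h_def by blast
  qed
  moreover have "shatters (Delta_k d k (h ` I)) (h ` I)"
    unfolding shatters_def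
  proof (intro equalityI subsetI)
    fix T assume "T \<in> Pow (h ` I)"
    then obtain S where S: "S \<subseteq> I" "T = h ` S" by (auto simp: subset_image_iff)
    obtain p where p: "\<forall>j\<le>k. p j \<in> euclid d" "aff_indep k p"
      "\<forall>i\<in>I. h i \<inter> open_simplex d k p \<noteq> {} \<longleftrightarrow> i \<in> S" using real[OF S(1)] by blast
    have "T = {g \<in> h ` I. g \<inter> open_simplex d k p \<noteq> {}}" using p(3) S by blast
    then have "T \<in> Delta_k d k (h ` I)" using p(1,2) unfolding Delta_k_def by blast
    moreover have "T = h ` I \<inter> T" using S by blast
    ultimately show "T \<in> {h ` I \<inter> S | S. S \<in> Delta_k d k (h ` I)}" by blast
  qed auto
  ultimately have "enat (card (h ` I)) \<le> vcdim (h ` I) (Delta_k d k (h ` I))"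
    unfolding vcdim_def using \<open>finite I\<close> by (intro Sup_upper) blast
  then show ?thesis
    using card_image[OF inj] \<open>\<And>i. i \<in> I \<Longrightarrow> hyperplane d (h i)\<close> by (intro exI[of _ "h ` I"]) auto
qed

section \<open>Two shattered families\<close>

text \<open>This serves small \<open>k\<close>. Each hyperplane fixes one coordinate to 1; a single
  point, repeated \<open>k\<close> times, with entries 0 on \<open>S\<close> and 2 elsewhere gives
  the pattern \<open>S\<close>.\<close>

lemma vcdim_Delta_k_ge_dim:
  assumes "1 \<le> k" "k \<le> d"
  shows "\<exists>\<H>. (\<forall>h\<in>\<H>. hyperplane d h) \<and> enat d \<le> vcdim \<H> (Delta_k d k \<H>)"
proof -
  let ?a = "\<lambda>i q. if q = i then 1 else 0 :: real"
  have sum: "(\<Sum>q<d. ?a i q * v q) = v i" if "i < d" for i and v :: "nat \<Rightarrow> real"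
    using that by (simp add: if_distrib[of "\<lambda>c. c * _"] sum.delta cong: if_cong)
  have "\<exists>\<H>. (\<forall>h\<in>\<H>. hyperplane d h) \<and> enat (card {..<d}) \<le> vcdim \<H> (Delta_k d k \<H>)"
  proof (rule card_le_vcdim_Delta_k[where a = ?a and base = "\<lambda>_. 2"])
    fix S assume "S \<subseteq> {..<d}"
    then show "\<exists>v. (\<forall>i\<in>S. \<exists>j<k. (\<Sum>q<d. ?a i q * v j q) < 1) \<and>
        (\<forall>i\<in>{..<d} - S. \<forall>j<k. (\<Sum>q<d. ?a i q * v j q) > 1)"
      using assms(1) by (intro exI[of _ "\<lambda>_ q. if q \<in> S then 0 else 2"]) (auto simp: sum subset_iff intro!: exI[of _ 0])
  qed (use assms sum in auto)
  then show ?thesis by simp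
qed

section \<open>Boxes in the plane as affine forms\<close>

text \<open>For \<open>L \<le> x < U\<close> both summands are at most \<open>1/8\<close>, otherwise one of them is at least \<open>1\<close>; hence the
  sum of two gauges is less than \<open>1\<close> inside a box and greater than \<open>1\<close> outside.\<close>

definition gauge :: "nat \<Rightarrow> nat \<Rightarrow> nat \<Rightarrow> real" where
  "gauge L U x = 8 ^ L / 8 * (1 / 8 ^ x) + 1 / 8 ^ U * 8 ^ x"

lemma gauge_pos: "gauge L U x > 0"
  by (simp add: gauge_def add_pos_pos)

lemma gauge_inside:
  assumes "L \<le> x" "x < U"
  shows "gauge L U x \<le> 1 / 4"
proof -
  have "(8::real) ^ L \<le> 8 ^ x" using assms by (intro power_increasing) auto
  moreover have "(8::real) ^ Suc x \<le> 8 ^ U" using assms by (intro power_increasing) auto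
  ultimately have "8 ^ L / 8 * (1 / 8 ^ x) \<le> (1 / 8 :: real)" "1 / 8 ^ U * 8 ^ x \<le> (1 / 8 :: real)"
    by (auto simp: field_simps)
  then show ?thesis unfolding gauge_def by linarith
qed

lemma gauge_outside:
  assumes "\<not> (L \<le> x \<and> x < U)"
  shows "gauge L U x > 1"
proof (cases "x < L")
  case True
  then have "(8::real) ^ Suc x \<le> 8 ^ L" by (intro power_increasing) auto
  then have "8 ^ L / 8 * (1 / 8 ^ x) \<ge> (1 :: real)" by (simp add: field_simps)
  moreover have "1 / 8 ^ U * 8 ^ x > (0 :: real)" by simp
  ultimately show ?thesis unfolding gauge_def by linarith
next
  case False
  then have "(8::real) ^ U \<le> 8 ^ x" using assms by (intro power_increasing) auto
  then have "1 / 8 ^ U * 8 ^ x \<ge> (1 :: real)" by (simp add: field_simps)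
  moreover have "8 ^ L / 8 * (1 / 8 ^ x) > (0 :: real)" by simp
  ultimately show ?thesis unfolding gauge_def by linarith
qed

lemma nat_div_eq_iff_interval:
  fixes x w c :: nat
  assumes "w > 0"
  shows "x div w = c \<longleftrightarrow> c * w \<le> x \<and> x < Suc c * w"
proof
  assume "x div w = c"
  then show "c * w \<le> x \<and> x < Suc c * w"
    using assms dividend_less_div_times[of w x] by (auto simp: div_times_less_eq_dividend)
next
  assume "c * w \<le> x \<and> x < Suc c * w"
  then show "x div w = c" by (intro div_nat_eqI) (auto simp: mult.commute)
qed

text \<open>The box \<open>L1 \<le> x < U1\<close>, \<open>L2 \<le> y r < U2\<close>, as a linear form on the points lifted below.\<close>

definition box_form :: "nat \<Rightarrow> nat \<Rightarrow> nat \<Rightarrow> nat \<Rightarrow> nat \<Rightarrow> nat \<Rightarrow> real" where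
  "box_form r L1 U1 L2 U2 q =
    (if q = 0 then 8 ^ L1 / 8 else if q = 1 then 1 / 8 ^ U1
     else if q = 2 + 2 * r then 8 ^ L2 / 8 else if q = 3 + 2 * r then 1 / 8 ^ U2 else 0)"

text \<open>One pair of coordinates for \<open>x\<close> is shared by all functions and each
  \<open>y r\<close> takes one more pair, so \<open>m\<close> functions fit when
  \<open>2 * m + 2 \<le> d\<close>.\<close>

definition lifted_point :: "nat \<Rightarrow> (nat \<Rightarrow> nat) \<Rightarrow> nat \<Rightarrow> real" where
  "lifted_point x y q =
    (if q = 0 then 1 / 8 ^ x else if q = 1 then 8 ^ x
     else if even q then 1 / 8 ^ y ((q - 2) div 2) else 8 ^ y ((q - 2) div 2))"

lemma sum_box_form:
  assumes "3 + 2 * r < d"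
  shows "(\<Sum>q<d. box_form r L1 U1 L2 U2 q * v q) =
    8 ^ L1 / 8 * v 0 + 1 / 8 ^ U1 * v 1 + 8 ^ L2 / 8 * v (2 + 2 * r) + 1 / 8 ^ U2 * v (3 + 2 * r)"
proof -
  have "(\<Sum>q<d. box_form r L1 U1 L2 U2 q * v q)
      = (\<Sum>q\<in>{0, 1, 2 + 2 * r, 3 + 2 * r}. box_form r L1 U1 L2 U2 q * v q)"
    using assms by (intro sum.mono_neutral_right) (auto simp: box_form_def)
  then show ?thesis by (simp add: box_form_def)
qed

lemma sum_box_form_lifted_point:
  assumes "3 + 2 * r < d"
  shows "(\<Sum>q<d. box_form r L1 U1 L2 U2 q * lifted_point x y q) = gauge L1 U1 x + gauge L2 U2 (y r)"
proof -
  have "(3 + 2 * r - 2) div 2 = r" by simp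
  then show ?thesis
    unfolding sum_box_form[OF assms] gauge_def by (simp add: lifted_point_def)
qed

text \<open>An index \<open>(r, t, A, B)\<close> is a switch of network \<open>r\<close>, and each
  stage has \<open>2 ^ (N - 1)\<close> of them. Turning on exactly the switches in \<open>S\<close>
  and lifting all inputs with their outputs hits exactly the boxes in \<open>S\<close>.\<close>

lemma vcdim_Delta_k_ge_boxes:
  assumes "2 ^ Suc N \<le> k" "k \<le> d" "2 * m + 2 \<le> d"
  shows "\<exists>\<H>. (\<forall>h\<in>\<H>. hyperplane d h) \<and> enat (m * (N * 2 ^ (N - 1))) \<le> vcdim \<H> (Delta_k d k \<H>)"
proof -
  define I where "I = {..<m} \<times> (SIGMA t:{..<N}. {..<(2::nat) ^ (N - 1 - t)} \<times> {..<(2::nat) ^ t})"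
  define a where "a = (\<lambda>(r, t, A, B). box_form r (2 * A * 2 ^ Suc t) (Suc (2 * A) * 2 ^ Suc t)
      ((2 * B + 1) * 2 ^ (N - 1 - t)) (Suc (2 * B + 1) * 2 ^ (N - 1 - t)))"
  have "card (SIGMA t:{..<N}. {..<(2::nat) ^ (N - 1 - t)} \<times> {..<(2::nat) ^ t})
      = (\<Sum>t<N. 2 ^ (N - 1 - t) * 2 ^ t)" by simp
  also have "\<dots> = (\<Sum>t<N. 2 ^ (N - 1))"
    by (intro sum.cong) (auto simp: power_add[symmetric])
  finally have card: "card I = m * (N * 2 ^ (N - 1))" by (simp add: I_def card_cartesian_product)
  have "\<exists>\<H>. (\<forall>h\<in>\<H>. hyperplane d h) \<and> enat (card I) \<le> vcdim \<H> (Delta_k d k \<H>)"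
  proof (rule card_le_vcdim_Delta_k[where a = a and base = "\<lambda>q. if q = 0 then 16 else 0"])
    show "finite I" by (simp add: I_def)
    fix i assume "i \<in> I"
    then obtain r t A B where i: "i = (r, t, A, B)" "r < m" by (auto simp: I_def)
    \<comment> \<open>At \<open>base\<close> the form has the value \<open>2 * 8 ^ L1\<close>, where
      \<open>L1\<close> is the lower end \<open>4 * (A * 2 ^ t)\<close> of the first
      interval.\<close>
    have "(1::real) \<le> 8 ^ (4 * (A * 2 ^ t))" by (rule one_le_power) simp
    then have "(1::real) < 2 * 8 ^ (4 * (A * 2 ^ t))" by linarith
    then show "(\<Sum>q<d. a i q * (if q = 0 then 16 else 0)) > 1"
      using i assms(3) by (simp add: a_def sum_box_form)
  next
    fix S assume S: "S \<subseteq> I"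
    define y where "y x r = net_out (\<lambda>t A B. (r, t, A, B) \<in> S) N x" for x r
    \<comment> \<open>There may be more than \<open>2 ^ Suc N\<close> points to place;
      \<open>mod\<close> repeats inputs, which adds no hits.\<close>
    define v where "v j = lifted_point (j mod 2 ^ Suc N) (y (j mod 2 ^ Suc N))" for j :: nat
    define inside where "inside = (\<lambda>(r, t, A, B) x.
        x div 2 ^ Suc t = 2 * A \<and> y x r div 2 ^ (N - 1 - t) = 2 * B + 1)"
    have hit: "(\<exists>x<2 ^ Suc N. inside i x) \<longleftrightarrow> i \<in> S" if "i \<in> I" for i
    proof -
      obtain r t A B where "i = (r, t, A, B)" "t < N" "A < 2 ^ (N - 1 - t)" "B < 2 ^ t"
        using \<open>i \<in> I\<close> by (auto simp: I_def)
      then show ?thesis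
        using net_hits_box_iff[of t N A B "\<lambda>t A B. (r, t, A, B) \<in> S"]
        by (simp add: inside_def y_def)
    qed
    have val: "(inside i x \<longrightarrow> (\<Sum>q<d. a i q * lifted_point x (y x) q) < 1) \<and>
        (\<not> inside i x \<longrightarrow> (\<Sum>q<d. a i q * lifted_point x (y x) q) > 1)" if "i \<in> I" for i x
    proof -
      obtain r t A B where i: "i = (r, t, A, B)" "r < m" using \<open>i \<in> I\<close> by (auto simp: I_def)
      let ?L1 = "2 * A * 2 ^ Suc t" and ?U1 = "Suc (2 * A) * 2 ^ Suc t"
      let ?L2 = "(2 * B + 1) * 2 ^ (N - 1 - t)" and ?U2 = "Suc (2 * B + 1) * 2 ^ (N - 1 - t)"
      have eq: "(\<Sum>q<d. a i q * lifted_point x (y x) q) = gauge ?L1 ?U1 x + gauge ?L2 ?U2 (y x r)"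
        using i assms(3) sum_box_form_lifted_point[of r d] by (simp add: a_def)
      have ins: "inside i x \<longleftrightarrow> (?L1 \<le> x \<and> x < ?U1) \<and> (?L2 \<le> y x r \<and> y x r < ?U2)"
        unfolding inside_def i prod.case by (simp only: nat_div_eq_iff_interval zero_less_power zero_less_numeral)
      show ?thesis
      proof (intro conjI impI)
        assume "inside i x"
        then have "gauge ?L1 ?U1 x \<le> 1 / 4" "gauge ?L2 ?U2 (y x r) \<le> 1 / 4"
          unfolding ins by (blast intro: gauge_inside)+
        then show "(\<Sum>q<d. a i q * lifted_point x (y x) q) < 1" unfolding eq by linarith
      next
        assume "\<not> inside i x"
        then have "gauge ?L1 ?U1 x > 1 \<or> gauge ?L2 ?U2 (y x r) > 1"
          unfolding ins by (blast intro: gauge_outside)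
        then show "(\<Sum>q<d. a i q * lifted_point x (y x) q) > 1"
          unfolding eq using gauge_pos[of ?L1 ?U1 x] gauge_pos[of ?L2 ?U2 "y x r"] by linarith
      qed
    qed
    show "\<exists>v. (\<forall>i\<in>S. \<exists>j<k. (\<Sum>q<d. a i q * v j q) < 1) \<and>
        (\<forall>i\<in>I - S. \<forall>j<k. (\<Sum>q<d. a i q * v j q) > 1)"
    proof (intro exI[of _ v] conjI ballI allI impI)
      fix i assume i: "i \<in> S"
      then obtain x where x: "x < 2 ^ Suc N" "inside i x" using hit S by blast
      then have "(\<Sum>q<d. a i q * v x q) < 1" using val[of i x] i S by (auto simp: v_def)
      then show "\<exists>j<k. (\<Sum>q<d. a i q * v j q) < 1" using x(1) assms(1) by (intro exI[of _ x]) auto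
    next
      fix i j assume i: "i \<in> I - S"
      have "\<not> inside i (j mod 2 ^ Suc N)" using hit[of i] i by auto
      then show "(\<Sum>q<d. a i q * v j q) > 1" using val[of i "j mod 2 ^ Suc N"] i by (auto simp: v_def)
    qed
  qed (use assms in auto)
  then show ?thesis by (simp add: card)
qed

theorem theorem3:
  shows "\<exists>c::real. c > 0 \<and> (\<forall>d k::nat. 4 \<le> d \<and> 1 \<le> k \<and> k \<le> d \<longrightarrow>
     (\<exists>\<H>. (\<forall>h\<in>\<H>. hyperplane d h) \<and>
        enat (nat \<lceil>c * real d * real k * log 2 (real k)\<rceil>) \<le> vcdim \<H> (Delta_k d k \<H>)))"
proof (intro exI[of _ "1 / 192 :: real"] conjI allI impI)
  fix d k :: nat
  assume dk: "4 \<le> d \<and> 1 \<le> k \<and> k \<le> d"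
  have reduce: "\<exists>\<H>. (\<forall>h\<in>\<H>. hyperplane d h) \<and>
        enat (nat \<lceil>1 / 192 * real d * real k * log 2 (real k)\<rceil>) \<le> vcdim \<H> (Delta_k d k \<H>)"
    if "\<exists>\<H>. (\<forall>h\<in>\<H>. hyperplane d h) \<and> enat M \<le> vcdim \<H> (Delta_k d k \<H>)"
      and "1 / 192 * real d * real k * log 2 (real k) \<le> real M" for M
  proof -
    have "nat \<lceil>1 / 192 * real d * real k * log 2 (real k)\<rceil> \<le> M"
      using that(2) by (simp add: nat_le_iff ceiling_le_iff)
    then show ?thesis using that(1) by (meson enat_ord_simps(1) order_trans)
  qed
  obtain n where n: "2 ^ n \<le> k" "k < 2 ^ Suc n"
    using ex_power_ivl1[of 2 k] dk by auto
  have "log 2 (real k) < real (Suc n)" using log2_of_power_less[OF n(2)] dk by simp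
  then have logk: "log 2 (real k) \<le> real (Suc n)" by simp
  have logk0: "log 2 (real k) \<ge> 0" using dk by simp
  show "\<exists>\<H>. (\<forall>h\<in>\<H>. hyperplane d h) \<and>
        enat (nat \<lceil>1 / 192 * real d * real k * log 2 (real k)\<rceil>) \<le> vcdim \<H> (Delta_k d k \<H>)"
  proof (cases "n \<le> 1")
    case True
    \<comment> \<open>Here \<open>k < 4\<close>, so \<open>k log k\<close> is bounded and the bound
      \<open>d\<close> suffices.\<close>
    have "(2::nat) ^ Suc n \<le> 2 ^ 2" using True by (intro power_increasing) auto
    then have "real k \<le> 4" using n(2) by simp
    then have "real k * log 2 (real k) \<le> 4 * 2" using logk logk0 True by (intro mult_mono) auto
    then have "real d * (real k * log 2 (real k)) \<le> real d * 8" by (intro mult_left_mono) auto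
    then have bound: "1 / 192 * real d * real k * log 2 (real k) \<le> real d" by simp
    have "1 \<le> k" "k \<le> d" using dk by auto
    from vcdim_Delta_k_ge_dim[OF this] bound show ?thesis by (rule reduce)
  next
    case False
    \<comment> \<open>A network of \<open>N\<close> stages takes inputs of \<open>N + 1 = n\<close>
      bits, hence \<open>2 ^ n \<le> k\<close> points.\<close>
    define N where "N = n - 1"
    define m where "m = (d - 2) div 2"
    have n_eq: "n = Suc N" "1 \<le> N" using False by (auto simp: N_def)
    have m: "real d \<le> 8 * real m" using dk unfolding m_def by linarith
    have "k < 8 * 2 ^ (N - 1)" using n(2) n_eq by (cases N) auto
    then have k: "real k \<le> 8 * 2 ^ (N - 1)"
      by (metis less_imp_le of_nat_le_iff of_nat_mult of_nat_numeral of_nat_power)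
    have l: "log 2 (real k) \<le> 3 * real N" using logk n_eq by simp
    have "real k * log 2 (real k) \<le> (8 * 2 ^ (N - 1)) * (3 * real N)"
      using k l logk0 by (intro mult_mono) auto
    then have "real d * (real k * log 2 (real k)) \<le> (8 * real m) * ((8 * 2 ^ (N - 1)) * (3 * real N))"
      using logk0 by (intro mult_mono[OF m]) simp_all
    \<comment> \<open>The factors 8, 8 and 3 lost in \<open>d\<close>, \<open>k\<close> and the
      logarithm multiply to 192.\<close>
    then have bound: "1 / 192 * real d * real k * log 2 (real k) \<le> real (m * (N * 2 ^ (N - 1)))"
      by (simp add: mult_ac)
    have "2 ^ Suc N \<le> k" "k \<le> d" "2 * m + 2 \<le> d" using n(1) n_eq(1) dk by (auto simp: m_def)
    from vcdim_Delta_k_ge_boxes[OF this] bound show ?thesis by (rule reduce)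
  qed
qed simp

end
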